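(* Let $G$ be a finite connected nonbipartite regular graph (loops and multiple edges allowed) with vertex set $V$ and vertex degree $d(v)=q+1\ge 3$ for all $v\in V$. There is a constant $C_G>0$ depending only on $G$ such that for every function $f:V\to\mathbb{R}$ there is a number $\beta_{\max}\in[q^{-1/2},1)$ such that for every directed edge $a$ in $G$ and every integer $r\ge 0$ $$\Big|M_{r,a}(f)-\frac{1}{|V|}\sum_{v\in V}f(v)\Big|\le C_G\,\|f\|_2\,\beta_{\max}^{\,r}.$$
   Context: A loop at a vertex contributes $2$ to its degree. The norm is $\|f\|_2=\langle f,f\rangle^{1/2}$ with $\langle f,g\rangle=\sum_{v\in V}f(v)g(v)$. Universal cover: $\widetilde G$ is the universal covering tree of $G$, with vertex set $\widetilde V$ and edge set $\widetilde E$: fix a root vertex of $G$; the vertices of $\widetilde G$ are the non-backtracking paths in $G$ starting at the root, two being adjacent if they differ by exactly one edge at the end. The projection $\pi:\widetilde G\to G$ sends a path to its end vertex (and edges to the corresponding edges). The lift of $f$ is $\tilde f=f\circ\pi$. $\delta$ is the combinatorial distance. Spheres and arcs: for $v_0\in\widetilde V$, $S_r(v_0)=\{v\in\widetilde V:\delta(v,v_0)=r\}$. For a directed edge $a$ of $\widetilde G$ from $w'$ to $w$, the vertex arcs are $A_0(a)=\{w'\}$ and $A_{r+1}(a)=S_{r+1}(w')\cap S_r(w)$ for $r\ge 0$. The arc average is $$M_{r,a}(f)=\frac{1}{|A_r(a)|}\sum_{x\in A_r(a)}\tilde f(x).$$ For a directed edge $a$ of $G$, $M_{r,a}(f)$ is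 computed using any lift of $a$ to a directed edge of $\widetilde G$ (the value does not depend on the lift). The constant $C_G$ does not depend on $a$, $f$, $r$; the rate $\beta_{\max}$ may depend on $G$ and $f$ but not on $a$ or $r$. *)

theory Defs
  imports
    "Graph_Theory.Bidirected_Digraph"
    "Graph_Theory.Digraph_Component"
    "Graph_Theory.Shortest_Path"
    "HOL-Analysis.L2_Norm"
begin

text \<open>
  An undirected multigraph, possibly with loops, is given by its directed edges: a
  \<^locale>\<open>bidirected_digraph\<close>, in which the fixed-point-free involution \<open>arev\<close> reverses
  directed edges, so that an undirected edge is a pair \<open>{a, arev a}\<close>. An undirected loop at
  \<open>v\<close> consists of two distinct arcs from \<open>v\<close> to \<open>v\<close>. Hence the degree of
  \<open>v\<close>, where loops count twice, is \<open>out_degree G v\<close>.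
\<close>

definition bipartite :: "('a, 'b) pre_digraph \<Rightarrow> bool" where
  "bipartite G \<longleftrightarrow> (\<exists>X Y. verts G = X \<union> Y \<and> X \<inter> Y = {} \<and>
     (\<forall>e \<in> arcs G. (tail G e \<in> X \<and> head G e \<in> Y) \<or> (tail G e \<in> Y \<and> head G e \<in> X)))"

definition non_backtracking :: "('b \<Rightarrow> 'b) \<Rightarrow> 'b list \<Rightarrow> bool" where
  "non_backtracking arev p \<longleftrightarrow> (\<forall>i. Suc i < length p \<longrightarrow> p ! Suc i \<noteq> arev (p ! i))"

text \<open>
  A non-backtracking path from the root \<open>x0\<close> is the list of its arcs; the empty list is the
  trivial path. The universal cover has no parallel edges, so its directed edges are ordered
  pairs of vertices.
\<close>

definition universal_cover ::
  "('a, 'b) pre_digraph \<Rightarrow> ('b \<Rightarrow> 'b) \<Rightarrow> 'a \<Rightarrow> ('b list, 'b list \<times> 'b list) pre_digraph" where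
  "universal_cover G arev x0 =
     (let V = {p. (\<exists>v. pre_digraph.awalk G x0 p v) \<and> non_backtracking arev p}
      in \<lparr> verts = V,
           arcs = {(p, p'). p \<in> V \<and> p' \<in> V \<and> ((\<exists>e. p' = p @ [e]) \<or> (\<exists>e. p = p' @ [e]))},
           tail = fst,
           head = snd \<rparr>)"

definition cover_vertex_proj :: "('a, 'b) pre_digraph \<Rightarrow> 'a \<Rightarrow> 'b list \<Rightarrow> 'a" where
  "cover_vertex_proj G x0 p = pre_digraph.awlast G x0 p"

definition cover_arc_proj :: "('b \<Rightarrow> 'b) \<Rightarrow> 'b list \<times> 'b list \<Rightarrow> 'b" where
  "cover_arc_proj arev a =
     (if length (fst a) < length (snd a) then last (snd a) else arev (last (fst a)))"

definition arc_lifts ::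
  "('a, 'b) pre_digraph \<Rightarrow> ('b \<Rightarrow> 'b) \<Rightarrow> 'a \<Rightarrow> 'b \<Rightarrow> ('b list \<times> 'b list) set" where
  "arc_lifts G arev x0 a = {a' \<in> arcs (universal_cover G arev x0). cover_arc_proj arev a' = a}"

text \<open>Combinatorial distance is \<open>wf_digraph.\<mu>\<close> with all arcs of weight 1.\<close>

definition sphere :: "('a, 'b) pre_digraph \<Rightarrow> nat \<Rightarrow> 'a \<Rightarrow> 'a set" where
  "sphere T r v0 = {v \<in> verts T. wf_digraph.\<mu> T (\<lambda>_. 1) v v0 = ereal (real r)}"

primrec vertex_arc :: "('a, 'b) pre_digraph \<Rightarrow> nat \<Rightarrow> 'b \<Rightarrow> 'a set" where
  "vertex_arc T 0 a = {tail T a}"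
| "vertex_arc T (Suc r) a = sphere T (Suc r) (tail T a) \<inter> sphere T r (head T a)"

definition arc_average ::
  "('a, 'b) pre_digraph \<Rightarrow> ('b \<Rightarrow> 'b) \<Rightarrow> 'a \<Rightarrow> nat \<Rightarrow> 'b list \<times> 'b list \<Rightarrow> ('a \<Rightarrow> real) \<Rightarrow> real" where
  "arc_average G arev x0 r a f =
     (let A = vertex_arc (universal_cover G arev x0) r a
      in (\<Sum>x\<in>A. (f \<circ> cover_vertex_proj G x0) x) / real (card A))"

lemma wf_universal_cover: "wf_digraph (universal_cover G arev x0)"
  by unfold_locales (auto simp: universal_cover_def Let_def)

lemma non_backtracking_snoc:
  "non_backtracking arev (p @ [e]) \<longleftrightarrow>
     non_backtracking arev p \<and> (p \<noteq> [] \<longrightarrow> e \<noteq> arev (last p))"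
proof (cases p rule: rev_cases)
  case (snoc ys y)
  have "(\<forall>i. Suc i < length ys + 2 \<longrightarrow> (ys @ [y, e]) ! Suc i \<noteq> arev ((ys @ [y, e]) ! i)) \<longleftrightarrow>
        (\<forall>i. Suc i < length ys + 1 \<longrightarrow> (ys @ [y, e]) ! Suc i \<noteq> arev ((ys @ [y, e]) ! i)) \<and>
        e \<noteq> arev y"
    by (auto simp: less_Suc_eq nth_append)
  moreover have "(ys @ [y, e]) ! i = (ys @ [y]) ! i" if "i < length ys + 1" for i
    using that by (auto simp: nth_append)
  ultimately show ?thesis
    unfolding non_backtracking_def snoc by auto
qed (simp add: non_backtracking_def)

text \<open>Every directed edge of a connected graph has a lift.\<close>

lemma arc_lifts_nonempty:
  assumes "bidirected_digraph G arev" and "Digraph_Component.connected G"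
    and "x0 \<in> verts G" and a: "a \<in> arcs G"
  shows "arc_lifts G arev x0 a \<noteq> {}"
proof -
  interpret bidirected_digraph G arev by fact
  have lift: "arc_lifts G arev x0 e \<noteq> {} \<and>
      (\<exists>p. awalk x0 p (head G e) \<and> non_backtracking arev p)"
    if p: "awalk x0 p (tail G e)" "non_backtracking arev p" and e: "e \<in> arcs G" for p e
  proof (cases "p \<noteq> [] \<and> e = arev (last p)")
    case True
    then obtain p' l where pl: "p = p' @ [l]" and el: "e = arev l"
      by (metis append_butlast_last_id)
    have l: "l \<in> arcs G" using p pl by auto
    have "awalk x0 p' (tail G l)"
      using p(1) pl by (auto simp: awalk_Cons_iff awalk_Nil_iff)
    moreover have "non_backtracking arev p'"
      using p(2) pl by (simp add: non_backtracking_snoc)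
    moreover from calculation p pl el have "(p, p') \<in> arc_lifts G arev x0 e"
      by (auto simp: arc_lifts_def cover_arc_proj_def universal_cover_def Let_def)
    ultimately show ?thesis using el l by auto
  next
    case False
    then have "non_backtracking arev (p @ [e])"
      using p(2) by (auto simp: non_backtracking_snoc)
    moreover have "awalk x0 (p @ [e]) (head G e)"
      using p(1) e by (auto simp: awalk_Cons_iff awalk_Nil_iff)
    moreover from calculation p have "(p, p @ [e]) \<in> arc_lifts G arev x0 e"
      by (auto simp: arc_lifts_def cover_arc_proj_def universal_cover_def Let_def)
    ultimately show ?thesis by blast
  qed
  have walk: "\<exists>p. awalk x0 p v \<and> non_backtracking arev p" if "awalk x0 p v" for p v
    using that
  proof (induction p arbitrary: v rule: rev_induct)
    case Nil
    then show ?case by (auto simp: non_backtracking_def)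
  next
    case (snoc e p)
    then have "awalk x0 p (tail G e)" "e \<in> arcs G" "v = head G e"
      by (auto simp: awalk_Cons_iff awalk_Nil_iff)
    then show ?case using snoc.IH lift by blast
  qed
  have "symmetric G"
    unfolding symmetric_conv using arev_in_arcs head_arev tail_arev by metis
  then have "x0 \<rightarrow>\<^sup>*\<^bsub>G\<^esub> tail G a"
    using assms(2,3) a reachable_mk_symmetric_eq
    by (auto simp: Digraph_Component.connected_def strongly_connected_def)
  then show ?thesis using walk lift a by (metis reachable_awalk)
qed

end

theory Submission
  imports Defs "HOL-Library.Sublist"
begin

text \<open>
  Arc averages are iterates of an averaging operator on the directed edges of \<open>G\<close>. In a tree,
  the vertex arc of radius \<open>r + 2\<close> issuing from a directed edge \<open>(p, p')\<close> is the disjoint union of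
  the vertex arcs of radius \<open>r + 1\<close> issuing from the directed edges \<open>(p', p'')\<close> with
  \<open>p'' \<noteq> p\<close>, and these \<open>q\<close> edges project bijectively to the non-backtracking continuations in
  \<open>G\<close> of the projected edge. So, if \<open>P\<close> is the operator \<open>nb_avg\<close> that averages a function on
  directed edges over the \<open>q\<close> non-backtracking continuations of an edge, the average over the vertex
  arc of radius \<open>r + 1\<close> is \<open>P\<^sup>r (f \<circ> head)\<close> (lemma \<open>arc_average_Suc\<close>). It remains
  to see that the powers of \<open>P\<close> converge exponentially to the projection onto the constants.

  Decompose a function \<open>g\<close> on directed edges at each vertex into
  the mean \<open>m\<close> over the edges leaving the vertex and the deviation \<open>h\<close> from it. Up to reversal of
  edges, \<open>P\<close> preserves \<open>m\<close> and multiplies \<open>h\<close> by \<open>- 1 / q\<close>, whence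
  \<open>\<parallel>P g\<parallel>\<^sup>2 = \<parallel>g\<parallel>\<^sup>2 - (1 - 1 / q\<^sup>2) \<parallel>h\<parallel>\<^sup>2\<close> (lemma
  \<open>energy_nb_avg\<close>). If two applications of \<open>P\<close> lose little norm, then both \<open>g\<close> and \<open>P g\<close>
  have small deviations, and then the mean of \<open>g\<close> at either endpoint of an edge is close to the mean
  of \<open>P g\<close> at the other endpoint (lemma \<open>tail_mean_step\<close>). Hence the means of \<open>g\<close> are
  close at any two vertices joined by a walk of even length. In a connected nonbipartite graph this
  covers all pairs of vertices, with walks of bounded length, so \<open>g\<close> is nearly constant; if \<open>g\<close>
  has sum \<open>0\<close>, it is small. Therefore \<open>P\<^sup>2\<close> is a strict contraction on the functions of sum
  \<open>0\<close> (lemma \<open>spectral_gap\<close>). The contraction factor is a property of the graph, so a single rate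
  serves every \<open>f\<close>.
\<close>

section \<open>Distances between words in a tree\<close>

text \<open>
  This is the length of the path from \<open>xs\<close> to \<open>ys\<close> in the tree of all words, where the
  neighbours of a word are its one-letter extensions and its longest proper prefix: the path goes
  through the longest common prefix.
\<close>

fun list_dist :: "'e list \<Rightarrow> 'e list \<Rightarrow> nat" where
  "list_dist [] ys = length ys"
| "list_dist xs [] = length xs"
| "list_dist (x # xs) (y # ys) =
     (if x = y then list_dist xs ys else length xs + length ys + 2)"

lemma list_dist_Nil_right [simp]: "list_dist xs [] = length xs"
  by (cases xs) auto

lemma list_dist_eq_0_iff [simp]: "list_dist xs ys = 0 \<longleftrightarrow> xs = ys"
  by (induction xs ys rule: list_dist.induct) auto

lemma list_dist_same [simp]: "list_dist xs xs = 0"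
  by simp

text \<open>
  The next two lemmas say everything about the tree that is used later: seen from \<open>xs\<close>, appending
  a letter to \<open>ys\<close> is a step towards \<open>xs\<close> exactly if the extended word is a prefix of \<open>xs\<close>,
  and otherwise a step away from \<open>xs\<close>.
\<close>

lemma list_dist_snoc_prefix:
  "prefix (ys @ [e]) xs \<Longrightarrow> list_dist xs ys = Suc (list_dist xs (ys @ [e]))"
  by (induction xs ys rule: list_dist.induct) (auto simp: prefix_Cons)

lemma list_dist_snoc_not_prefix:
  "\<not> prefix (ys @ [e]) xs \<Longrightarrow> list_dist xs (ys @ [e]) = Suc (list_dist xs ys)"
proof (induction xs ys rule: list_dist.induct)
  case (2 v va)
  then show ?case by (cases va) auto
qed auto

section \<open>The universal cover as a tree\<close>

declare vertex_arc.simps(2) [simp del]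

locale rooted_bidirected_digraph = bidirected_digraph G arev
  for G :: "('a, 'b) pre_digraph" and arev +
  fixes x0
  assumes x0_in_verts: "x0 \<in> verts G"
begin

abbreviation T where "T \<equiv> universal_cover G arev x0"

lemma wf_T: "wf_digraph T"
  by (rule wf_universal_cover)

lemma verts_T: "verts T = {p. (\<exists>v. awalk x0 p v) \<and> non_backtracking arev p}"
  and arcs_T: "arcs T = {(p, p'). p \<in> verts T \<and> p' \<in> verts T \<and>
     ((\<exists>e. p' = p @ [e]) \<or> (\<exists>e. p = p' @ [e]))}"
  and tail_T [simp]: "tail T = fst" and head_T [simp]: "head T = snd"
  by (auto simp: universal_cover_def Let_def)

lemma verts_T_snoc_iff:
  "p @ [e] \<in> verts T \<longleftrightarrow>
     p \<in> verts T \<and> e \<in> out_arcs G (awlast x0 p) \<and> (p \<noteq> [] \<longrightarrow> e \<noteq> arev (last p))"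
  by (auto simp: verts_T non_backtracking_snoc awalk_Cons_iff awalk_Nil_iff)

lemma verts_T_prefix: "prefix p p' \<Longrightarrow> p' \<in> verts T \<Longrightarrow> p \<in> verts T"
proof (induction p' rule: rev_induct)
  case (snoc e p')
  then have "p' \<in> verts T" by (simp add: verts_T_snoc_iff)
  then show ?case
    using snoc by (auto simp: prefix_snoc)
qed simp

lemma cover_vertex_proj_snoc:
  "p @ [e] \<in> verts T \<Longrightarrow> cover_vertex_proj G x0 (p @ [e]) = head G e"
  by (auto simp: cover_vertex_proj_def awlast_append)

lemma arcs_T_sym: "(p, p') \<in> arcs T \<longleftrightarrow> (p', p) \<in> arcs T"
  by (auto simp: arcs_T)

lemma cover_arc_proj_swap:
  "(p, p') \<in> arcs T \<Longrightarrow> cover_arc_proj arev (p', p) = arev (cover_arc_proj arev (p, p'))"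
  unfolding arcs_T cover_arc_proj_def by (elim CollectE case_prodE) (clarsimp, elim disjE exE, simp_all)

lemma cover_arc_proj:
  assumes "(p, p') \<in> arcs T"
  shows "cover_arc_proj arev (p, p') \<in> arcs G"
    and "tail G (cover_arc_proj arev (p, p')) = cover_vertex_proj G x0 p"
    and "head G (cover_arc_proj arev (p, p')) = cover_vertex_proj G x0 p'"
proof -
  have snoc: "e \<in> arcs G \<and> tail G e = cover_vertex_proj G x0 u \<and>
      head G e = cover_vertex_proj G x0 (u @ [e])" if "u @ [e] \<in> verts T" for u e
    using that cover_vertex_proj_snoc[OF that] by (simp add: verts_T_snoc_iff cover_vertex_proj_def)
  from assms consider e where "p' = p @ [e]" "p' \<in> verts T" | e where "p = p' @ [e]" "p \<in> verts T"
    by (auto simp: arcs_T)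
  then have "cover_arc_proj arev (p, p') \<in> arcs G \<and>
      tail G (cover_arc_proj arev (p, p')) = cover_vertex_proj G x0 p \<and>
      head G (cover_arc_proj arev (p, p')) = cover_vertex_proj G x0 p'"
  proof cases
    case 1
    then show ?thesis using snoc[of p e] by (simp add: cover_arc_proj_def)
  next
    case 2
    then show ?thesis using snoc[of p' e] by (simp add: cover_arc_proj_def)
  qed
  then show "cover_arc_proj arev (p, p') \<in> arcs G"
    and "tail G (cover_arc_proj arev (p, p')) = cover_vertex_proj G x0 p"
    and "head G (cover_arc_proj arev (p, p')) = cover_vertex_proj G x0 p'"
    by auto
qed

text \<open>
  The covering property: the star of a vertex of the cover maps bijectively to the edges leaving its
  projection. The edge back to the parent is the lift of the reversal of the last edge of the path,
  the one edge by which a non-backtracking path cannot be extended.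
\<close>

lemma cover_arc_proj_star:
  assumes "p' \<in> verts T"
  shows "bij_betw (\<lambda>p''. cover_arc_proj arev (p', p'')) {p''. (p', p'') \<in> arcs T}
    (out_arcs G (cover_vertex_proj G x0 p'))"
  unfolding bij_betw_def
proof
  show "inj_on (\<lambda>p''. cover_arc_proj arev (p', p'')) {p''. (p', p'') \<in> arcs T}"
  proof (rule inj_onI, clarsimp)
    have no_return: "p @ [e, arev e] \<notin> verts T" for p e
      using verts_T_snoc_iff[of "p @ [e]" "arev e"] by simp
    fix p1 p2
    assume "(p', p1) \<in> arcs T" "(p', p2) \<in> arcs T"
      and "cover_arc_proj arev (p', p1) = cover_arc_proj arev (p', p2)"
    then show "p1 = p2"
      by (auto simp: arcs_T cover_arc_proj_def no_return)
  qed
  show "(\<lambda>p''. cover_arc_proj arev (p', p'')) ` {p''. (p', p'') \<in> arcs T} =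
    out_arcs G (cover_vertex_proj G x0 p')"
  proof (intro equalityI subsetI)
    fix e assume e: "e \<in> out_arcs G (cover_vertex_proj G x0 p')"
    show "e \<in> (\<lambda>p''. cover_arc_proj arev (p', p'')) ` {p''. (p', p'') \<in> arcs T}"
    proof (cases "p' \<noteq> [] \<and> e = arev (last p')")
      case True
      then have p': "p' = butlast p' @ [last p']" by simp
      then have "butlast p' \<in> verts T"
        using assms verts_T_snoc_iff by metis
      then have "(p', butlast p') \<in> arcs T"
        using p' assms by (auto simp: arcs_T)
      then show ?thesis
        using True by (intro image_eqI[of _ _ "butlast p'"]) (auto simp: cover_arc_proj_def)
    next
      case False
      then have "(p', p' @ [e]) \<in> arcs T"
        using e assms by (auto simp: arcs_T verts_T_snoc_iff cover_vertex_proj_def)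
      then show ?thesis
        by (intro image_eqI[of _ _ "p' @ [e]"]) (auto simp: cover_arc_proj_def)
    qed
  qed (use cover_arc_proj in auto)
qed

lemma list_dist_arc_cases:
  assumes "(v, v') \<in> arcs T"
  shows "list_dist x v' = Suc (list_dist x v) \<or> list_dist x v = Suc (list_dist x v')"
proof -
  have snoc: "list_dist x (u @ [e]) = Suc (list_dist x u) \<or>
      list_dist x u = Suc (list_dist x (u @ [e]))" for u e
    using list_dist_snoc_prefix list_dist_snoc_not_prefix by metis
  from assms consider e where "v' = v @ [e]" | e where "v = v' @ [e]"
    by (auto simp: arcs_T)
  then show ?thesis
    by cases (use snoc in blast)+
qed

text \<open>
  The neighbour of \<open>v\<close> on the way to \<open>x\<close> is the extension of \<open>v\<close> by the next letter of
  \<open>x\<close> if \<open>v\<close> is a prefix of \<open>x\<close>, and the parent of \<open>v\<close> otherwise. Uniqueness is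
  what makes the cover a tree.
\<close>

lemma ex1_arc_list_dist:
  assumes x: "x \<in> verts T" and v: "v \<in> verts T" and "x \<noteq> v"
  shows "\<exists>!v'. (v, v') \<in> arcs T \<and> list_dist x v = Suc (list_dist x v')"
proof (cases "prefix v x")
  case True
  with \<open>x \<noteq> v\<close> obtain e where e: "prefix (v @ [e]) x"
    by (metis append_one_prefix prefix_length_less prefix_order.less_le)
  show ?thesis
  proof (rule ex1I[of _ "v @ [e]"])
    show "(v, v @ [e]) \<in> arcs T \<and> list_dist x v = Suc (list_dist x (v @ [e]))"
      using list_dist_snoc_prefix[OF e] verts_T_prefix[OF e x] v by (auto simp: arcs_T)
  next
    fix v' assume v': "(v, v') \<in> arcs T \<and> list_dist x v = Suc (list_dist x v')"
    from v' consider e' where "v' = v @ [e']" | e' where "v = v' @ [e']"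
      by (auto simp: arcs_T)
    then show "v' = v @ [e]"
    proof cases
      case 1
      then have "prefix (v @ [e']) x"
        using v' list_dist_snoc_not_prefix[of v e' x] by auto
      with e 1 show ?thesis by (auto simp: prefix_def)
    next
      case 2
      with True v' list_dist_snoc_prefix[of v' e' x] show ?thesis by auto
    qed
  qed
next
  case False
  then have v_eq: "v = butlast v @ [last v]" by (cases v) auto
  have 1: "list_dist x v = Suc (list_dist x (butlast v))"
    using list_dist_snoc_not_prefix[of "butlast v" "last v" x] False v_eq by simp
  show ?thesis
  proof (rule ex1I[of _ "butlast v"])
    have "butlast v \<in> verts T"
      using v v_eq verts_T_snoc_iff by metis
    then show "(v, butlast v) \<in> arcs T \<and> list_dist x v = Suc (list_dist x (butlast v))"
      using 1 v v_eq by (auto simp: arcs_T)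
  next
    fix v' assume v': "(v, v') \<in> arcs T \<and> list_dist x v = Suc (list_dist x v')"
    from v' consider e' where "v' = v @ [e']" | e' where "v = v' @ [e']"
      by (auto simp: arcs_T)
    then show "v' = butlast v"
    proof cases
      case 1
      with v' list_dist_snoc_not_prefix[of v e' x] False
      show ?thesis by (auto dest: append_prefixD)
    qed simp
  qed
qed

text \<open>
  A step in the cover changes \<open>list_dist x\<close> by one, so no walk is shorter; following the neighbours
  that lie closer to \<open>x\<close> gives a walk of this length.
\<close>

lemma distance_T:
  assumes x: "x \<in> verts T" and v: "v \<in> verts T"
  shows "wf_digraph.\<mu> T (\<lambda>_. 1) x v = ereal (real (list_dist x v))"
proof -
  interpret T: wf_digraph T by (rule wf_T)
  have cost: "T.awalk_cost (\<lambda>_. 1) p = real (length p)" for p :: "('b list \<times> 'b list) list"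
    by (induction p) auto
  have lower: "list_dist x v \<le> length p" if "T.awalk x p v" for p v
    using that
  proof (induction p arbitrary: v rule: rev_induct)
    case (snoc a p)
    then have "T.awalk x p (fst a)" "(fst a, v) \<in> arcs T"
      by (auto simp: T.awalk_Cons_iff T.awalk_Nil_iff)
    with snoc.IH[of "fst a"] list_dist_arc_cases[of "fst a" v x] show ?case by auto
  qed (auto simp: T.awalk_Nil_iff)
  have walk: "\<exists>p. T.awalk x p v \<and> length p = list_dist x v" if "v \<in> verts T" for v
    using that
  proof (induction "list_dist x v" arbitrary: v)
    case 0
    then show ?case using x by (auto simp: T.awalk_Nil_iff)
  next
    case (Suc n)
    then have "x \<noteq> v" by auto
    then obtain v' where v': "(v, v') \<in> arcs T" "list_dist x v = Suc (list_dist x v')"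
      using ex1_arc_list_dist[OF x Suc.prems] by blast
    then have "(v', v) \<in> arcs T" "v' \<in> verts T"
      using arcs_T_sym by (auto simp: arcs_T)
    moreover obtain p where "T.awalk x p v'" "length p = list_dist x v'"
      using Suc v' \<open>v' \<in> verts T\<close> by auto
    ultimately have "T.awalk x (p @ [(v', v)]) v \<and> length (p @ [(v', v)]) = list_dist x v"
      using v'(2) Suc.prems by (auto simp: T.awalk_Cons_iff T.awalk_Nil_iff)
    then show ?case by blast
  qed
  obtain p where p: "T.awalk x p v" "length p = list_dist x v"
    using walk[OF v] by blast
  show ?thesis
  proof (rule antisym)
    show "T.\<mu> (\<lambda>_. 1) x v \<le> ereal (real (list_dist x v))"
      using T.min_cost_le_walk_cost[OF p(1), of "\<lambda>_. 1"] p(2) cost by simp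
    show "ereal (real (list_dist x v)) \<le> T.\<mu> (\<lambda>_. 1) x v"
      unfolding T.\<mu>_def using lower cost by (auto intro!: INF_greatest)
  qed
qed

lemma vertex_arc_Suc:
  assumes "(p, p') \<in> arcs T"
  shows "vertex_arc T (Suc r) (p, p') =
    {x \<in> verts T. list_dist x p = Suc r \<and> list_dist x p' = r}"
  using assms by (auto simp: vertex_arc.simps(2) sphere_def distance_T arcs_T)

lemma vertex_arc_1:
  assumes "(p, p') \<in> arcs T"
  shows "vertex_arc T (Suc 0) (p, p') = {p'}"
  using assms list_dist_arc_cases[OF assms, of p'] by (auto simp: vertex_arc_Suc arcs_T)

text \<open>
  In the vertex arc of radius \<open>r + 2\<close>, the next vertex on the way from \<open>p'\<close> to \<open>x\<close> is some
  \<open>p'' \<noteq> p\<close>. Conversely, if that next vertex is not \<open>p\<close>, then \<open>p\<close> lies one step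
  further from \<open>x\<close> than \<open>p'\<close> does.
\<close>

lemma vertex_arc_Suc_Suc:
  assumes "(p, p') \<in> arcs T"
  shows "vertex_arc T (Suc (Suc r)) (p, p') =
    (\<Union>p''\<in>{p''. (p', p'') \<in> arcs T \<and> p'' \<noteq> p}. vertex_arc T (Suc r) (p', p''))"
    (is "?L = ?R")
proof (intro equalityI subsetI)
  fix x assume "x \<in> ?L"
  then have x: "x \<in> verts T" "list_dist x p = Suc (Suc r)" "list_dist x p' = Suc r"
    using assms by (auto simp: vertex_arc_Suc)
  then have "x \<noteq> p'" by auto
  then obtain p'' where p'': "(p', p'') \<in> arcs T" "list_dist x p' = Suc (list_dist x p'')"
    using ex1_arc_list_dist[of x p'] x assms by (auto simp: arcs_T)
  then show "x \<in> ?R"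
    using x by (auto simp: vertex_arc_Suc)
next
  fix x assume "x \<in> ?R"
  then obtain p'' where p'': "(p', p'') \<in> arcs T" "p'' \<noteq> p"
    and x: "x \<in> verts T" "list_dist x p' = Suc r" "list_dist x p'' = r"
    by (auto simp: vertex_arc_Suc)
  then have "x \<noteq> p'" by auto
  have "(p', p) \<in> arcs T" using assms arcs_T_sym by blast
  have "p' \<in> verts T" using assms by (auto simp: arcs_T)
  then have "\<exists>!v'. (p', v') \<in> arcs T \<and> list_dist x p' = Suc (list_dist x v')"
    using ex1_arc_list_dist \<open>x \<noteq> p'\<close> x(1) by blast
  then have "list_dist x p' \<noteq> Suc (list_dist x p)"
    using p'' x \<open>(p', p) \<in> arcs T\<close> by metis
  then have "list_dist x p = Suc (Suc r)"
    using list_dist_arc_cases[OF \<open>(p', p) \<in> arcs T\<close>, of x] x by auto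
  then show "x \<in> ?L" using assms x by (auto simp: vertex_arc_Suc)
qed

lemma vertex_arc_disjoint:
  assumes "(p', p1) \<in> arcs T" "(p', p2) \<in> arcs T" "p1 \<noteq> p2"
  shows "vertex_arc T (Suc r) (p', p1) \<inter> vertex_arc T (Suc r) (p', p2) = {}"
proof -
  have False if "x \<in> vertex_arc T (Suc r) (p', p1)" "x \<in> vertex_arc T (Suc r) (p', p2)" for x
  proof -
    have x: "x \<in> verts T" "list_dist x p' = Suc r" "list_dist x p1 = r" "list_dist x p2 = r"
      using that assms by (auto simp: vertex_arc_Suc)
    then have "x \<noteq> p'" by auto
    moreover have "p' \<in> verts T" using assms by (auto simp: arcs_T)
    ultimately have "\<exists>!v'. (p', v') \<in> arcs T \<and> list_dist x p' = Suc (list_dist x v')"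
      using ex1_arc_list_dist x(1) by blast
    with x assms show False by metis
  qed
  then show ?thesis by blast
qed

text \<open>
  The edge back to \<open>p\<close> is the lift of the reversed edge, so removing it from the star of \<open>p'\<close>
  leaves the lifts of the non-backtracking continuations.
\<close>

lemma cover_arc_proj_successors:
  assumes "(p, p') \<in> arcs T"
  defines "a \<equiv> cover_arc_proj arev (p, p')"
  shows "bij_betw (\<lambda>p''. cover_arc_proj arev (p', p'')) {p''. (p', p'') \<in> arcs T \<and> p'' \<noteq> p}
    (out_arcs G (head G a) - {arev a})"
proof -
  have "p' \<in> verts T" and ret: "(p', p) \<in> arcs T"
    using assms arcs_T_sym by (auto simp: arcs_T)
  then have "bij_betw (\<lambda>p''. cover_arc_proj arev (p', p'')) {p''. (p', p'') \<in> arcs T}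
      (out_arcs G (head G a))"
    using cover_arc_proj_star cover_arc_proj(3)[OF assms(1)] by (simp add: a_def)
  moreover have "{p''. (p', p'') \<in> arcs T \<and> p'' \<noteq> p} = {p''. (p', p'') \<in> arcs T} - {p}"
    by blast
  ultimately show ?thesis
    using ret cover_arc_proj_swap[OF assms(1)]
    by (auto simp: bij_betw_def a_def inj_on_image_set_diff[where C = "{p''. (p', p'') \<in> arcs T}"]
        intro: inj_on_diff)
qed

end

section \<open>Arc averages as iterated non-backtracking averages\<close>

locale regular_bidirected_digraph = fin_digraph G + bidirected_digraph G arev
  for G :: "('a, 'b) pre_digraph" and arev +
  fixes q :: nat
  assumes regular: "v \<in> verts G \<Longrightarrow> out_degree G v = q + 1"
    and q_ge_2: "q \<ge> 2"
begin

definition nb_avg :: "('b \<Rightarrow> real) \<Rightarrow> 'b \<Rightarrow> real" where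
  "nb_avg g a = (\<Sum>b\<in>out_arcs G (head G a) - {arev a}. g b) / real q"

lemma q_pos: "real q > 0"
  using q_ge_2 by simp

lemma card_out_arcs: "v \<in> verts G \<Longrightarrow> card (out_arcs G v) = q + 1"
  using regular by (simp add: out_degree_def)

lemma nb_avg_cong:
  assumes "\<And>b. b \<in> arcs G \<Longrightarrow> g b = h b"
  shows "nb_avg g a = nb_avg h a"
  unfolding nb_avg_def using assms by (auto intro!: sum.cong arg_cong2[where f = "(/)"])

lemma funpow_nb_avg_affine:
  assumes "a \<in> arcs G"
  shows "(nb_avg ^^ r) (\<lambda>b. g b - c) a = (nb_avg ^^ r) g a - c"
  using assms
proof (induction r arbitrary: a)
  case (Suc r)
  have "card (out_arcs G (head G a) - {arev a}) = q"
    using Suc.prems card_out_arcs[of "head G a"] by (simp add: finite_out_arcs)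
  moreover have "nb_avg ((nb_avg ^^ r) (\<lambda>b. g b - c)) a = nb_avg (\<lambda>b. (nb_avg ^^ r) g b - c) a"
    using Suc.IH by (rule nb_avg_cong)
  ultimately show ?case
    using q_pos nb_avg_def[of "\<lambda>b. (nb_avg ^^ r) g b - c" a] nb_avg_def[of "(nb_avg ^^ r) g" a]
    by (simp add: sum_subtractf diff_divide_distrib)
qed simp

text \<open>
  Sums over vertex arcs obey the recursion that defines the powers of \<open>nb_avg\<close>, up to the
  normalisation \<open>q\<^sup>r\<close>. The radius starts at \<open>1\<close>, where the vertex arc is the head of the
  edge.
\<close>

lemma sum_vertex_arc:
  fixes F :: "'a \<Rightarrow> real" and r :: nat
  assumes "x0 \<in> verts G" and "(p, p') \<in> arcs (universal_cover G arev x0)"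
  defines "A \<equiv> vertex_arc (universal_cover G arev x0) (Suc r) (p, p')"
  shows "finite A \<and> (\<Sum>x\<in>A. F (cover_vertex_proj G x0 x)) =
    real q ^ r * (nb_avg ^^ r) (F \<circ> head G) (cover_arc_proj arev (p, p'))"
proof -
  interpret rooted_bidirected_digraph G arev x0
    by unfold_locales fact
  show ?thesis
    unfolding A_def using assms(2)
  proof (induction r arbitrary: p p')
    case 0
    then show ?case by (simp add: vertex_arc_1 cover_arc_proj)
  next
    case (Suc r)
    let ?a = "cover_arc_proj arev (p, p')"
    let ?N = "{p''. (p', p'') \<in> arcs T \<and> p'' \<noteq> p}"
    let ?V = "\<lambda>p''. vertex_arc T (Suc r) (p', p'')"
    let ?h = "(nb_avg ^^ r) (F \<circ> head G)"
    note bij = cover_arc_proj_successors[OF Suc.prems]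
    have fin: "finite ?N"
      using bij_betw_finite[OF bij] by (simp add: finite_out_arcs)
    have "(\<Sum>x\<in>(\<Union>p''\<in>?N. ?V p''). F (cover_vertex_proj G x0 x)) =
        (\<Sum>p''\<in>?N. \<Sum>x\<in>?V p''. F (cover_vertex_proj G x0 x))"
      using Suc.IH fin vertex_arc_disjoint by (intro sum.UNION_disjoint) auto
    also have "\<dots> = (\<Sum>p''\<in>?N. real q ^ r * ?h (cover_arc_proj arev (p', p'')))"
      using Suc.IH by (intro sum.cong refl) blast
    also have "\<dots> = real q ^ r * (\<Sum>b\<in>out_arcs G (head G ?a) - {arev ?a}. ?h b)"
      using sum.reindex_bij_betw[OF bij, of ?h] by (simp flip: sum_distrib_left)
    also have "\<dots> = real q ^ Suc r * (nb_avg ^^ Suc r) (F \<circ> head G) ?a"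
      using q_pos nb_avg_def[of ?h ?a] by simp
    finally have sum: "(\<Sum>x\<in>(\<Union>p''\<in>?N. ?V p''). F (cover_vertex_proj G x0 x)) =
      real q ^ Suc r * (nb_avg ^^ Suc r) (F \<circ> head G) ?a" .
    have "finite (\<Union>p''\<in>?N. ?V p'')"
      using fin Suc.IH by blast
    then show ?case
      unfolding vertex_arc_Suc_Suc[OF Suc.prems] using sum by (rule conjI)
  qed
qed

text \<open>
  The cardinality is the sum of the constant function \<open>1\<close>, which \<open>nb_avg\<close> fixes.
\<close>

lemma card_vertex_arc:
  assumes "x0 \<in> verts G" and "(p, p') \<in> arcs (universal_cover G arev x0)"
  shows "card (vertex_arc (universal_cover G arev x0) (Suc r) (p, p')) = q ^ r"
proof -
  interpret rooted_bidirected_digraph G arev x0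
    by unfold_locales fact
  have "(nb_avg ^^ r) ((\<lambda>_. 1) \<circ> head G) (cover_arc_proj arev (p, p')) =
      (nb_avg ^^ r) (\<lambda>_. 0) (cover_arc_proj arev (p, p')) + 1"
    using funpow_nb_avg_affine[OF cover_arc_proj(1)[OF assms(2)], of r "\<lambda>_. 1" 1]
    by (simp add: comp_def)
  moreover have "(nb_avg ^^ r) (\<lambda>_. 0) = (\<lambda>_. 0)"
    by (induction r) (auto simp: nb_avg_def)
  ultimately have "real (card (vertex_arc T (Suc r) (p, p'))) = real (q ^ r)"
    using sum_vertex_arc[OF assms, where F = "\<lambda>_. 1" and r = r] by simp
  then show ?thesis by (simp only: of_nat_eq_iff)
qed

lemma arc_average_Suc:
  assumes "x0 \<in> verts G" and "a' \<in> arc_lifts G arev x0 a"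
  shows "arc_average G arev x0 (Suc r) a' f = (nb_avg ^^ r) (f \<circ> head G) a"
proof -
  obtain p p' where "a' = (p, p')" by (cases a')
  then show ?thesis
    using assms sum_vertex_arc[OF assms(1), where p = p and p' = p' and F = f and r = r] card_vertex_arc[OF assms(1), of p p' r] q_pos
    by (simp add: arc_lifts_def arc_average_def)
qed

lemma arc_average_0:
  assumes "x0 \<in> verts G" and "a' \<in> arc_lifts G arev x0 a"
  shows "arc_average G arev x0 0 a' f = f (tail G a)"
proof -
  interpret rooted_bidirected_digraph G arev x0
    by unfold_locales fact
  show ?thesis
    using assms(2) cover_arc_proj(2)
    by (cases a') (auto simp: arc_lifts_def arc_average_def)
qed

section \<open>Loss of energy under averaging\<close>

definition energy :: "('b \<Rightarrow> real) \<Rightarrow> real" where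
  "energy g = (\<Sum>a\<in>arcs G. (g a)\<^sup>2)"

definition tail_mean :: "('b \<Rightarrow> real) \<Rightarrow> 'a \<Rightarrow> real" where
  "tail_mean g v = (\<Sum>b\<in>out_arcs G v. g b) / (real q + 1)"

definition tail_dev :: "('b \<Rightarrow> real) \<Rightarrow> 'b \<Rightarrow> real" where
  "tail_dev g b = g b - tail_mean g (tail G b)"

lemma sum_arcs_by_tail: "(\<Sum>b\<in>arcs G. F b) = (\<Sum>v\<in>verts G. \<Sum>b\<in>out_arcs G v. F b)"
  unfolding out_arcs_def by (rule sum.group[symmetric]) auto

lemma sum_arcs_tail: "(\<Sum>b\<in>arcs G. \<phi> (tail G b)) = (real q + 1) * (\<Sum>v\<in>verts G. \<phi> v)"
proof -
  have "(\<Sum>b\<in>arcs G. \<phi> (tail G b)) = (\<Sum>v\<in>verts G. \<Sum>b\<in>out_arcs G v. \<phi> v)"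
    unfolding sum_arcs_by_tail by (intro sum.cong) auto
  then show ?thesis
    by (simp add: card_out_arcs sum_distrib_left add.commute)
qed

lemma sum_arcs_arev: "(\<Sum>b\<in>arcs G. F (arev b)) = (\<Sum>b\<in>arcs G. F b)"
  using sum.permute[OF arev_permutes_arcs, of F] by (simp add: comp_def)

lemma sum_arcs_head: "(\<Sum>b\<in>arcs G. \<phi> (head G b)) = (real q + 1) * (\<Sum>v\<in>verts G. \<phi> v)"
  using sum_arcs_arev[of "\<lambda>b. \<phi> (tail G b)"] sum_arcs_tail by simp

text \<open>
  Functions that depend only on the tail are orthogonal to deviations, which sum to \<open>0\<close> over the
  edges leaving any vertex.
\<close>

lemma sum_tail_dev: "(\<Sum>b\<in>arcs G. \<phi> (tail G b) * tail_dev g b) = 0"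
proof -
  have "(\<Sum>b\<in>out_arcs G v. \<phi> (tail G b) * tail_dev g b) = 0" if "v \<in> verts G" for v
  proof -
    have "(\<Sum>b\<in>out_arcs G v. \<phi> (tail G b) * tail_dev g b) =
        (\<Sum>b\<in>out_arcs G v. \<phi> v * (g b - tail_mean g v))"
      by (intro sum.cong) (auto simp: tail_dev_def)
    also have "\<dots> = \<phi> v * ((\<Sum>b\<in>out_arcs G v. g b) - (real q + 1) * tail_mean g v)"
      using card_out_arcs[OF that] by (simp add: sum_subtractf flip: sum_distrib_left)
    finally show ?thesis by (simp add: tail_mean_def)
  qed
  then show ?thesis by (simp add: sum_arcs_by_tail)
qed

text \<open>
  The continuations of \<open>arev b\<close> are the \<open>q\<close> edges other than \<open>b\<close> that leave the tail of
  \<open>b\<close>, so their average is the mean of all \<open>q + 1\<close> edges, corrected by the deviation of \<open>b\<close>.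
\<close>

lemma nb_avg_arev:
  assumes "b \<in> arcs G"
  shows "nb_avg g (arev b) = tail_mean g (tail G b) - tail_dev g b / real q"
proof -
  have "(\<Sum>e\<in>out_arcs G (tail G b) - {b}. g e) = (real q + 1) * tail_mean g (tail G b) - g b"
    using assms by (simp add: sum_diff1 finite_out_arcs tail_mean_def)
  then show ?thesis
    using assms q_pos by (simp add: nb_avg_def tail_dev_def field_simps)
qed

lemma sum_nb_avg: "(\<Sum>b\<in>arcs G. nb_avg g b) = (\<Sum>b\<in>arcs G. g b)"
proof -
  have "(\<Sum>b\<in>arcs G. tail_dev g b) = 0"
    using sum_tail_dev[of "\<lambda>_. 1" g] by simp
  moreover have "(\<Sum>b\<in>arcs G. nb_avg g b) =
      (\<Sum>b\<in>arcs G. tail_mean g (tail G b) - tail_dev g b / real q)"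
    unfolding sum_arcs_arev[of "nb_avg g", symmetric] by (simp add: nb_avg_arev)
  moreover have "(\<Sum>b\<in>arcs G. g b) = (\<Sum>b\<in>arcs G. tail_mean g (tail G b) + tail_dev g b)"
    by (simp add: tail_dev_def)
  ultimately show ?thesis
    by (simp add: sum.distrib sum_subtractf flip: sum_divide_distrib)
qed

text \<open>
  By the preceding formula, after reversal of edges \<open>nb_avg\<close> keeps the mean part and multiplies the
  deviation by \<open>- 1 / q\<close>; the two parts are orthogonal before and after.
\<close>

lemma energy_nb_avg:
  "energy (nb_avg g) = energy g - (1 - 1 / (real q)\<^sup>2) * energy (tail_dev g)"
proof -
  \<comment> \<open>The case \<open>c = 1\<close> gives the energy of \<open>g\<close>, the case \<open>c = - 1 / q\<close> that of \<open>nb_avg g\<close>.\<close>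
  have square: "(\<Sum>b\<in>arcs G. (tail_mean g (tail G b) + c * tail_dev g b)\<^sup>2) =
      (\<Sum>b\<in>arcs G. (tail_mean g (tail G b))\<^sup>2) + c\<^sup>2 * energy (tail_dev g)" for c
  proof -
    have "(\<Sum>b\<in>arcs G. (tail_mean g (tail G b) + c * tail_dev g b)\<^sup>2) =
        (\<Sum>b\<in>arcs G. (tail_mean g (tail G b))\<^sup>2 + c\<^sup>2 * (tail_dev g b)\<^sup>2 +
           2 * c * (tail_mean g (tail G b) * tail_dev g b))"
      by (intro sum.cong) (auto simp: power2_eq_square algebra_simps)
    then show ?thesis
      using sum_tail_dev[of "tail_mean g" g]
      by (simp add: sum.distrib energy_def flip: sum_distrib_left)
  qed
  have "energy (nb_avg g) =
      (\<Sum>b\<in>arcs G. (tail_mean g (tail G b) + (- 1 / real q) * tail_dev g b)\<^sup>2)"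
    unfolding energy_def sum_arcs_arev[of "\<lambda>b. (nb_avg g b)\<^sup>2", symmetric]
    by (simp add: nb_avg_arev)
  moreover have "energy g = (\<Sum>b\<in>arcs G. (tail_mean g (tail G b) + 1 * tail_dev g b)\<^sup>2)"
    by (simp add: energy_def tail_dev_def)
  ultimately show ?thesis
    unfolding square by (simp add: power_divide algebra_simps)
qed

lemma energy_nonneg: "energy g \<ge> 0"
  by (simp add: energy_def sum_nonneg)

lemma square_le_energy: "a \<in> arcs G \<Longrightarrow> (g a)\<^sup>2 \<le> energy g"
  unfolding energy_def by (rule member_le_sum) auto

section \<open>Almost constant means along walks\<close>

lemma abs_tail_dev_le:
  assumes "b \<in> arcs G" and "energy (tail_dev g) \<le> s\<^sup>2" and "s \<ge> 0"
  shows "\<bar>tail_dev g b\<bar> \<le> s"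
proof -
  have "(tail_dev g b)\<^sup>2 \<le> s\<^sup>2"
    using square_le_energy[of b "tail_dev g"] assms by linarith
  then show ?thesis
    using abs_le_square_iff[of "tail_dev g b" s] \<open>s \<ge> 0\<close> by simp
qed

text \<open>
  The value \<open>nb_avg g b\<close> is close to the mean of \<open>g\<close> at the head of \<open>b\<close>, because the
  deviation of \<open>g\<close> is small, and close to the mean of \<open>nb_avg g\<close> at the tail of \<open>b\<close>, because
  the deviation of \<open>nb_avg g\<close> is small.
\<close>

lemma tail_mean_step:
  assumes s: "energy (tail_dev g) \<le> s\<^sup>2" "energy (tail_dev (nb_avg g)) \<le> s\<^sup>2" "s \<ge> 0"
    and b: "b \<in> arcs G"
  shows "\<bar>tail_mean g (head G b) - tail_mean (nb_avg g) (tail G b)\<bar> \<le> 2 * s"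
proof -
  have "nb_avg g b = tail_mean g (head G b) - tail_dev g (arev b) / real q"
    using nb_avg_arev[of "arev b" g] b by simp
  then have "tail_mean g (head G b) - tail_mean (nb_avg g) (tail G b) =
      tail_dev g (arev b) / real q + tail_dev (nb_avg g) b"
    by (simp add: tail_dev_def)
  moreover have "\<bar>tail_dev g (arev b) / real q\<bar> \<le> \<bar>tail_dev g (arev b)\<bar>"
    using q_ge_2 by (simp add: divide_le_eq mult_le_cancel_left1)
  moreover have "\<bar>tail_dev g (arev b)\<bar> \<le> s" "\<bar>tail_dev (nb_avg g) b\<bar> \<le> s"
    using abs_tail_dev_le s b by auto
  ultimately show ?thesis by linarith
qed

text \<open>
  The preceding lemma, applied to an edge and to its reversal, lets a step of a walk replace the mean
  of \<open>g\<close> by that of \<open>nb_avg g\<close> or the other way round, so only the parity of the length matters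
  for the mean that is reached.
\<close>

lemma tail_mean_walk:
  assumes s: "energy (tail_dev g) \<le> s\<^sup>2" "energy (tail_dev (nb_avg g)) \<le> s\<^sup>2" "s \<ge> 0"
    and "awalk x p y"
  shows "\<bar>tail_mean g x - (if even (length p) then tail_mean g y else tail_mean (nb_avg g) y)\<bar>
    \<le> real (length p) * (2 * s)"
  using assms(4)
proof (induction p arbitrary: y rule: rev_induct)
  case (snoc b p)
  then have b: "b \<in> arcs G" "y = head G b" and "awalk x p (tail G b)"
    by (auto simp: awalk_Cons_iff awalk_Nil_iff)
  note IH = snoc.IH[OF this(3)]
  have len: "real (length (p @ [b])) * (2 * s) = real (length p) * (2 * s) + 2 * s"
    by (simp add: algebra_simps)
  show ?case
  proof (cases "even (length p)")
    case True
    then have end_mean: "(if even (length (p @ [b])) then tail_mean g y else tail_mean (nb_avg g) y) =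
        tail_mean (nb_avg g) (head G b)"
      using b(2) by simp
    have "\<bar>tail_mean g x - tail_mean g (tail G b)\<bar> \<le> real (length p) * (2 * s)"
      using IH True by simp
    moreover have "\<bar>tail_mean g (tail G b) - tail_mean (nb_avg g) (head G b)\<bar> \<le> 2 * s"
      using tail_mean_step[OF s, of "arev b"] b(1) by simp
    ultimately show ?thesis
      unfolding end_mean len by linarith
  next
    case False
    then have end_mean: "(if even (length (p @ [b])) then tail_mean g y else tail_mean (nb_avg g) y) =
        tail_mean g (head G b)"
      using b(2) by simp
    have "\<bar>tail_mean g x - tail_mean (nb_avg g) (tail G b)\<bar> \<le> real (length p) * (2 * s)"
      using IH False by simp
    then show ?thesis
      unfolding end_mean len using tail_mean_step[OF s b(1)] by linarith
  qed
qed (auto simp: awalk_Nil_iff)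

end

section \<open>Even walks in nonbipartite graphs\<close>

context bidirected_digraph
begin

lemma reachable_if_connected:
  assumes "Digraph_Component.connected G" "x \<in> verts G" "y \<in> verts G"
  shows "\<exists>p. awalk x p y"
proof -
  have "x \<rightarrow>\<^sup>*\<^bsub>G\<^esub> y"
    using assms reachable_mk_symmetric_eq[OF sym_arcs]
    by (auto simp: Digraph_Component.connected_def strongly_connected_def)
  then show ?thesis by (simp add: reachable_awalk)
qed

text \<open>
  If no vertex were reachable from \<open>x\<close> by walks of both parities, the parity would be a
  bipartition. From one vertex that is reachable in both ways, the property spreads along walks to
  all vertices.
\<close>

lemma even_walk_if_not_bipartite:
  assumes conn: "Digraph_Component.connected G" and nonbip: "\<not> bipartite G"
    and x: "x \<in> verts G" and y: "y \<in> verts G"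
  shows "\<exists>p. awalk x p y \<and> even (length p)"
proof -
  define X where "X = {z. \<exists>p. awalk x p z \<and> even (length p)}"
  define Y where "Y = {z. \<exists>p. awalk x p z \<and> odd (length p)}"
  have snoc: "awalk x (p @ [e]) (head G e)" if "awalk x p (tail G e)" "e \<in> arcs G" for p e
    using that by (auto simp: awalk_Cons_iff awalk_Nil_iff)
  have XY: "head G e \<in> Y" if "e \<in> arcs G" "tail G e \<in> X" for e
  proof -
    from that(2) obtain p where "awalk x p (tail G e)" "even (length p)" by (auto simp: X_def)
    then show ?thesis
      using snoc[OF _ that(1)] unfolding Y_def by (intro CollectI exI[of _ "p @ [e]"]) simp
  qed
  have YX: "head G e \<in> X" if "e \<in> arcs G" "tail G e \<in> Y" for e
  proof -
    from that(2) obtain p where "awalk x p (tail G e)" "odd (length p)" by (auto simp: Y_def)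
    then show ?thesis
      using snoc[OF _ that(1)] unfolding X_def by (intro CollectI exI[of _ "p @ [e]"]) simp
  qed
  have cover: "verts G = X \<union> Y"
    using reachable_if_connected[OF conn x] unfolding X_def Y_def by auto
  have "X \<inter> Y \<noteq> {}"
  proof
    assume "X \<inter> Y = {}"
    then have "bipartite G"
      using XY YX cover unfolding bipartite_def
      by (intro exI[of _ X] exI[of _ Y]) (metis Un_iff tail_in_verts)
    with nonbip show False ..
  qed
  then obtain z where z: "z \<in> X \<inter> Y" by blast
  then have "z \<in> verts G" using cover by blast
  then obtain p where "awalk z p y"
    using reachable_if_connected[OF conn _ y] by blast
  then have "y \<in> X \<inter> Y"
    using z
  proof (induction p arbitrary: z)
    case (Cons e p)
    then show ?case using XY YX by (auto simp: awalk_Cons_iff)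
  qed (simp add: awalk_Nil_iff)
  then show ?thesis by (auto simp: X_def)
qed

end

section \<open>Contraction and convergence\<close>

lemma sum_diff_mean_square_le:
  fixes f :: "'x \<Rightarrow> real"
  shows "(\<Sum>x\<in>A. (f x - (\<Sum>x\<in>A. f x) / real (card A))\<^sup>2) \<le> (\<Sum>x\<in>A. (f x)\<^sup>2)"
proof -
  define c where "c = (\<Sum>x\<in>A. f x) / real (card A)"
  have "(\<Sum>x\<in>A. f x) = real (card A) * c"
    by (cases "finite A \<and> A \<noteq> {}") (auto simp: c_def)
  moreover have "(\<Sum>x\<in>A. (f x - c)\<^sup>2) = (\<Sum>x\<in>A. (f x)\<^sup>2) - 2 * c * (\<Sum>x\<in>A. f x) + real (card A) * c\<^sup>2"
    by (simp add: power2_diff sum.distrib sum_subtractf sum_distrib_left sum_distrib_right mult_ac)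
  ultimately have "(\<Sum>x\<in>A. (f x - c)\<^sup>2) = (\<Sum>x\<in>A. (f x)\<^sup>2) - real (card A) * c\<^sup>2"
    by (simp add: power2_eq_square)
  then show ?thesis by (simp add: c_def[symmetric])
qed

context regular_bidirected_digraph
begin

lemma ex_even_walk_bound:
  assumes "Digraph_Component.connected G" "\<not> bipartite G"
  shows "\<exists>N. \<forall>x\<in>verts G. \<forall>y\<in>verts G. \<exists>p. awalk x p y \<and> even (length p) \<and> length p \<le> N"
proof -
  have "\<forall>z\<in>verts G \<times> verts G. \<exists>p. awalk (fst z) p (snd z) \<and> even (length p)"
    using even_walk_if_not_bipartite[OF assms] by auto
  then obtain w where w: "\<And>z. z \<in> verts G \<times> verts G \<Longrightarrow>
      awalk (fst z) (w z) (snd z) \<and> even (length (w z))"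
    by metis
  define N where "N = Max ((length \<circ> w) ` (verts G \<times> verts G))"
  have "length (w z) \<le> N" if "z \<in> verts G \<times> verts G" for z
    unfolding N_def using that by (intro Max_ge) auto
  then have "\<exists>p. awalk x p y \<and> even (length p) \<and> length p \<le> N"
    if "x \<in> verts G" "y \<in> verts G" for x y
    using w[of "(x, y)"] that by (intro exI[of _ "w (x, y)"]) simp
  then show ?thesis by blast
qed

text \<open>
  A Poincare inequality: a function of sum \<open>0\<close> has energy at most \<open>D\<close> times the energies of
  its deviation and that of its average, and two averagings lose \<open>1 - 1 / q\<^sup>2\<close> times their sum.
  Here \<open>q \<ge> 2\<close> makes the loss positive.
\<close>

lemma spectral_gap:
  assumes "Digraph_Component.connected G" "\<not> bipartite G"
  shows "\<exists>\<gamma>\<ge>0. \<gamma> < 1 \<and> (\<forall>g. (\<Sum>b\<in>arcs G. g b) = 0 \<longrightarrow>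
    energy (nb_avg (nb_avg g)) \<le> \<gamma> * energy g)"
proof -
  obtain N where N: "\<And>x y. x \<in> verts G \<Longrightarrow> y \<in> verts G \<Longrightarrow>
      \<exists>p. awalk x p y \<and> even (length p) \<and> length p \<le> N"
    using ex_even_walk_bound[OF assms] by blast
  define D where "D = real (card (arcs G)) * (2 * real N + 2)\<^sup>2"
  define \<kappa> where "\<kappa> = 1 - 1 / (real q)\<^sup>2"
  have \<kappa>: "0 < \<kappa>" "\<kappa> \<le> 1"
    using q_ge_2 by (auto simp: \<kappa>_def divide_simps power_strict_increasing one_less_power)
  have D: "D \<ge> 0" by (simp add: D_def)
  have gap: "energy g \<le> D * (energy (tail_dev g) + energy (tail_dev (nb_avg g)))"
    if mean: "(\<Sum>b\<in>arcs G. g b) = 0" for g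
  proof -
    define s where "s = sqrt (energy (tail_dev g) + energy (tail_dev (nb_avg g)))"
    have s0: "s \<ge> 0" and s2: "s\<^sup>2 = energy (tail_dev g) + energy (tail_dev (nb_avg g))"
      using energy_nonneg by (auto simp: s_def)
    then have s: "energy (tail_dev g) \<le> s\<^sup>2" "energy (tail_dev (nb_avg g)) \<le> s\<^sup>2" "s \<ge> 0"
      using energy_nonneg[of "tail_dev g"] energy_nonneg[of "tail_dev (nb_avg g)"] by auto
    \<comment> \<open>The means at the two tails differ by at most \<open>2 N s\<close>, and each deviation adds at most \<open>s\<close>.\<close>
    have diff: "g b - g b' \<le> (2 * real N + 2) * s" if b: "b \<in> arcs G" "b' \<in> arcs G" for b b'
    proof -
      obtain p where p: "awalk (tail G b) p (tail G b')" "even (length p)" "length p \<le> N"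
        using N[of "tail G b" "tail G b'"] b by auto
      have "tail_mean g (tail G b) - tail_mean g (tail G b') \<le> real (length p) * (2 * s)"
        using tail_mean_walk[OF s p(1)] p(2) by (auto simp: abs_le_iff)
      also have "\<dots> \<le> real N * (2 * s)"
        using p(3) s0 by (intro mult_right_mono) auto
      finally have "tail_mean g (tail G b) - tail_mean g (tail G b') \<le> real N * (2 * s)" .
      moreover have "\<bar>tail_dev g b\<bar> \<le> s" "\<bar>tail_dev g b'\<bar> \<le> s"
        using abs_tail_dev_le s b by auto
      ultimately show ?thesis
        unfolding tail_dev_def by (simp add: algebra_simps abs_le_iff)
    qed
    \<comment> \<open>As \<open>g\<close> has mean \<open>0\<close>, the value \<open>g b\<close> is the mean of its differences to all values.\<close>
    have bound: "(g b)\<^sup>2 \<le> ((2 * real N + 2) * s)\<^sup>2" if b: "b \<in> arcs G" for b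
    proof -
      have card: "real (card (arcs G)) > 0"
        using b by (auto simp: card_gt_0_iff)
      have sum_const: "(\<Sum>b'\<in>arcs G. g b - g b') = real (card (arcs G)) * g b"
        using mean by (simp add: sum_subtractf)
      have "real (card (arcs G)) * g b \<le> real (card (arcs G)) * ((2 * real N + 2) * s)"
        unfolding sum_const[symmetric] using diff b by (intro sum_bounded_above) auto
      moreover have "real (card (arcs G)) * (- ((2 * real N + 2) * s)) \<le> real (card (arcs G)) * g b"
        unfolding sum_const[symmetric] using diff b
        by (intro sum_bounded_below) (smt (verit, best))
      ultimately have "g b \<le> (2 * real N + 2) * s" "- ((2 * real N + 2) * s) \<le> g b"
        using card by (simp_all only: mult_le_cancel_left_pos)
      then have "\<bar>g b\<bar> \<le> (2 * real N + 2) * s"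
        by linarith
      then show ?thesis
        using abs_le_square_iff[of "g b" "(2 * real N + 2) * s"] s0 by simp
    qed
    have "energy g \<le> (\<Sum>b\<in>arcs G. ((2 * real N + 2) * s)\<^sup>2)"
      unfolding energy_def by (intro sum_mono bound)
    also have "\<dots> = D * s\<^sup>2"
      by (simp add: D_def power_mult_distrib)
    finally show ?thesis by (simp add: s2)
  qed
  \<comment> \<open>Dividing by \<open>D + 1\<close> rather than \<open>D\<close> avoids a division by \<open>0\<close> and keeps \<open>\<gamma>\<close> nonnegative.\<close>
  define \<gamma> where "\<gamma> = 1 - \<kappa> / (D + 1)"
  show ?thesis
  proof (intro exI[of _ \<gamma>] conjI allI impI)
    show "\<gamma> \<ge> 0" "\<gamma> < 1"
      using \<kappa> D by (auto simp: \<gamma>_def divide_simps)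
    fix g :: "'b \<Rightarrow> real"
    assume mean: "(\<Sum>b\<in>arcs G. g b) = 0"
    define E where "E = energy (tail_dev g) + energy (tail_dev (nb_avg g))"
    have "E \<ge> 0" by (simp add: E_def energy_nonneg)
    have "energy g \<le> (D + 1) * E"
      using gap[OF mean] \<open>E \<ge> 0\<close> by (simp add: E_def algebra_simps)
    then have "\<kappa> * energy g \<le> \<kappa> * ((D + 1) * E)"
      using \<kappa> by (intro mult_left_mono) auto
    then have "\<kappa> / (D + 1) * energy g \<le> \<kappa> * E"
      using D by (simp add: pos_divide_le_eq mult_ac)
    moreover have "energy (nb_avg (nb_avg g)) = energy g - \<kappa> * E"
      by (simp add: energy_nb_avg[of "nb_avg g"] energy_nb_avg[of g] E_def \<kappa>_def algebra_simps)
    ultimately show "energy (nb_avg (nb_avg g)) \<le> \<gamma> * energy g"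
      by (simp add: \<gamma>_def algebra_simps)
  qed
qed

lemma energy_nb_avg_le: "energy (nb_avg g) \<le> energy g"
proof -
  have "1 / (real q)\<^sup>2 \<le> 1"
    using q_ge_2 by (simp add: divide_simps)
  then show ?thesis
    using energy_nonneg[of "tail_dev g"] by (simp add: energy_nb_avg)
qed

lemma energy_funpow_le:
  assumes \<gamma>: "\<gamma> \<ge> 0"
    and gap: "\<And>g. (\<Sum>b\<in>arcs G. g b) = 0 \<Longrightarrow> energy (nb_avg (nb_avg g)) \<le> \<gamma> * energy g"
    and mean: "(\<Sum>b\<in>arcs G. g b) = 0"
  shows "energy ((nb_avg ^^ r) g) \<le> \<gamma> ^ (r div 2) * energy g"
proof -
  have mean': "(\<Sum>b\<in>arcs G. (nb_avg ^^ n) g b) = 0" for n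
    by (induction n) (simp_all add: mean sum_nb_avg)
  have even_power: "energy ((nb_avg ^^ (2 * k)) g) \<le> \<gamma> ^ k * energy g" for k
  proof (induction k)
    case (Suc k)
    have "energy ((nb_avg ^^ (2 * Suc k)) g) \<le> \<gamma> * energy ((nb_avg ^^ (2 * k)) g)"
      using gap[OF mean'[of "2 * k"]] by simp
    also have "\<dots> \<le> \<gamma> * (\<gamma> ^ k * energy g)"
      using Suc \<gamma> by (rule mult_left_mono)
    finally show ?case by simp
  qed simp
  show ?thesis
  proof (cases "even r")
    case True
    then show ?thesis using even_power[of "r div 2"] by simp
  next
    case False
    then have "r = Suc (2 * (r div 2))" by simp
    then have "energy ((nb_avg ^^ r) g) \<le> energy ((nb_avg ^^ (2 * (r div 2))) g)"
      using energy_nb_avg_le[of "(nb_avg ^^ (2 * (r div 2))) g"] by (metis comp_apply funpow.simps(2))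
    then show ?thesis using even_power[of "r div 2"] by linarith
  qed
qed

text \<open>
  Regularity makes every vertex the head of equally many edges, so the limit, an average over edges,
  is the average of \<open>f\<close> over the vertices.
\<close>

lemma sum_head_mean:
  "(\<Sum>b\<in>arcs G. f (head G b)) / real (card (arcs G)) = (\<Sum>v\<in>verts G. f v) / real (card (verts G))"
proof -
  have "real (card (arcs G)) = (real q + 1) * real (card (verts G))"
    using sum_arcs_head[of "\<lambda>_. 1"] by simp
  then show ?thesis by (simp add: sum_arcs_head)
qed

lemma funpow_nb_avg_minus_mean:
  assumes \<gamma>: "\<gamma> \<ge> 0"
    and gap: "\<And>g. (\<Sum>b\<in>arcs G. g b) = 0 \<Longrightarrow> energy (nb_avg (nb_avg g)) \<le> \<gamma> * energy g"
    and a: "a \<in> arcs G"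
  shows "\<bar>(nb_avg ^^ r) (f \<circ> head G) a - (\<Sum>v\<in>verts G. f v) / real (card (verts G))\<bar>
    \<le> sqrt (\<gamma> ^ (r div 2)) * (sqrt (real q + 1) * L2_set f (verts G))"
proof -
  define c where "c = (\<Sum>v\<in>verts G. f v) / real (card (verts G))"
  define g where "g b = (f \<circ> head G) b - c" for b
  have "card (arcs G) \<noteq> 0" using a by auto
  then have mean: "(\<Sum>b\<in>arcs G. g b) = 0"
    unfolding g_def c_def sum_head_mean[symmetric] by (simp add: sum_subtractf)
  have "energy g \<le> (\<Sum>b\<in>arcs G. (f (head G b))\<^sup>2)"
    unfolding energy_def g_def c_def comp_def sum_head_mean[symmetric]
    by (rule sum_diff_mean_square_le)
  then have energy_g: "energy g \<le> (real q + 1) * (\<Sum>v\<in>verts G. (f v)\<^sup>2)"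
    using sum_arcs_head[of "\<lambda>v. (f v)\<^sup>2"] by simp
  have "((nb_avg ^^ r) g a)\<^sup>2 \<le> energy ((nb_avg ^^ r) g)"
    using a by (rule square_le_energy)
  also have "\<dots> \<le> \<gamma> ^ (r div 2) * energy g"
    by (rule energy_funpow_le[OF \<gamma> gap mean])
  also have "\<dots> \<le> \<gamma> ^ (r div 2) * ((real q + 1) * (\<Sum>v\<in>verts G. (f v)\<^sup>2))"
    using energy_g \<gamma> by (intro mult_left_mono) auto
  finally have "\<bar>(nb_avg ^^ r) g a\<bar> \<le>
      sqrt (\<gamma> ^ (r div 2) * ((real q + 1) * (\<Sum>v\<in>verts G. (f v)\<^sup>2)))"
    by (rule real_le_rsqrt[of "\<bar>_\<bar>", simplified])
  moreover have "(nb_avg ^^ r) g a = (nb_avg ^^ r) (f \<circ> head G) a - c"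
    unfolding g_def by (rule funpow_nb_avg_affine[OF a])
  ultimately show ?thesis
    by (simp add: c_def L2_set_def real_sqrt_mult)
qed

end

lemma abs_diff_mean_le_L2_set:
  fixes f :: "'x \<Rightarrow> real"
  assumes "finite A" "x \<in> A"
  shows "\<bar>f x - (\<Sum>x\<in>A. f x) / real (card A)\<bar> \<le> L2_set f A"
proof -
  have "(f x - (\<Sum>x\<in>A. f x) / real (card A))\<^sup>2 \<le>
      (\<Sum>y\<in>A. (f y - (\<Sum>x\<in>A. f x) / real (card A))\<^sup>2)"
    using assms by (intro member_le_sum) auto
  also have "\<dots> \<le> (\<Sum>y\<in>A. (f y)\<^sup>2)"
    by (rule sum_diff_mean_square_le)
  finally show ?thesis
    unfolding L2_set_def by (rule real_le_rsqrt[of "\<bar>_\<bar>", simplified])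
qed

theorem theorem1:
  fixes G :: "('a, 'b) pre_digraph" and arev :: "'b \<Rightarrow> 'b" and q :: nat
  assumes "fin_digraph G" and "bidirected_digraph G arev"
    and "Digraph_Component.connected G" and "\<not> bipartite G"
    and "\<forall>v \<in> verts G. out_degree G v = q + 1" and "q + 1 \<ge> 3"
  shows "\<exists>C::real. C > 0 \<and>
    (\<forall>f :: 'a \<Rightarrow> real. \<exists>\<beta>::real. real q powr (- 1 / 2) \<le> \<beta> \<and> \<beta> < 1 \<and>
      (\<forall>a \<in> arcs G. \<forall>r::nat. \<forall>x0 \<in> verts G. \<forall>a' \<in> arc_lifts G arev x0 a.
        \<bar>arc_average G arev x0 r a' f - (\<Sum>v\<in>verts G. f v) / real (card (verts G))\<bar>
          \<le> C * L2_set f (verts G) * \<beta> ^ r))"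
proof -
  interpret fin_digraph G by fact
  interpret bidirected_digraph G arev by fact
  interpret regular_bidirected_digraph G arev q
    using assms(5,6) by unfold_locales auto
  obtain \<gamma> where \<gamma>: "\<gamma> \<ge> 0" "\<gamma> < 1"
    and gap: "\<And>g. (\<Sum>b\<in>arcs G. g b) = 0 \<Longrightarrow> energy (nb_avg (nb_avg g)) \<le> \<gamma> * energy g"
    using spectral_gap[OF assms(3,4)] by blast
  \<comment> \<open>Two averagings multiply the squared norm by \<open>\<gamma>\<close>, hence the fourth root.\<close>
  define \<beta> where "\<beta> = max (real q powr (- 1 / 2)) (sqrt (sqrt \<gamma>))"
  have "real q powr (- 1 / 2) < 1"
    using q_ge_2 powr_less_mono[of "- 1 / 2" 0 "real q"] by simp
  with \<gamma> have \<beta>1: "\<beta> < 1" by (simp add: \<beta>_def)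
  have \<beta>0: "\<beta> > 0" using q_pos by (simp add: \<beta>_def less_max_iff_disj)
  \<comment> \<open>The factor \<open>\<beta>\<^sup>2\<close> pays for the first step, which takes no averaging, and for a possibly odd one.\<close>
  define C where "C = sqrt (real q + 1) / \<beta>\<^sup>2"
  have C1: "C \<ge> 1"
  proof -
    have "\<beta>\<^sup>2 \<le> 1" using \<beta>0 \<beta>1 by (simp add: power_le_one)
    also have "1 \<le> sqrt (real q + 1)" by simp
    finally show ?thesis using \<beta>0 by (simp add: C_def le_divide_eq)
  qed
  have bound: "\<bar>arc_average G arev x0 r a' f - (\<Sum>v\<in>verts G. f v) / real (card (verts G))\<bar>
      \<le> C * L2_set f (verts G) * \<beta> ^ r"
    if a: "a \<in> arcs G" and x0: "x0 \<in> verts G" and a': "a' \<in> arc_lifts G arev x0 a"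
    for f a r x0 a'
  proof (cases r)
    case 0
    have "L2_set f (verts G) \<le> C * L2_set f (verts G)"
      using mult_right_mono[OF C1 L2_set_nonneg[of f "verts G"]] by simp
    with 0 show ?thesis
      using abs_diff_mean_le_L2_set[of "verts G" "tail G a" f] a arc_average_0[OF x0 a', of f] by simp
  next
    case (Suc n)
    have "sqrt (\<gamma> ^ (n div 2)) = (sqrt (sqrt \<gamma>)) ^ (2 * (n div 2))"
      using \<gamma> by (simp add: real_sqrt_power power_mult)
    also have "\<dots> \<le> \<beta> ^ (2 * (n div 2))"
      using \<gamma> by (intro power_mono) (auto simp: \<beta>_def)
    also have "\<dots> = \<beta> ^ (2 * (n div 2) + 2) / \<beta>\<^sup>2"
      using \<beta>0 by (subst power_add) simp
    also have "\<dots> \<le> \<beta> ^ r / \<beta>\<^sup>2"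
      using \<beta>0 \<beta>1 Suc by (intro divide_right_mono power_decreasing) auto
    finally have rate: "sqrt (\<gamma> ^ (n div 2)) \<le> \<beta> ^ r / \<beta>\<^sup>2" .
    have "\<bar>(nb_avg ^^ n) (f \<circ> head G) a - (\<Sum>v\<in>verts G. f v) / real (card (verts G))\<bar>
        \<le> sqrt (\<gamma> ^ (n div 2)) * (sqrt (real q + 1) * L2_set f (verts G))"
      by (rule funpow_nb_avg_minus_mean[OF \<gamma>(1) gap a])
    also have "\<dots> \<le> \<beta> ^ r / \<beta>\<^sup>2 * (sqrt (real q + 1) * L2_set f (verts G))"
      using rate by (intro mult_right_mono) (auto simp: L2_set_nonneg)
    finally show ?thesis
      using arc_average_Suc[OF x0 a', of n f] Suc by (simp add: C_def mult_ac)
  qed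
  have "real q powr (- 1 / 2) \<le> \<beta>" by (simp add: \<beta>_def)
  then show ?thesis
    using C1 \<beta>1 bound by (intro exI[of _ C] conjI allI exI[of _ \<beta>]) auto
qed

end
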